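(* Let $n \in \mathbb{N}$, $n \ge 1$, and let $p(t) = \sum_{k=0}^m a_k t^k \in \mathbb{R}[t]$ with $a_m \neq 0$. Then $p \in \mathscr{P}_n^{\rm mon}$ (that is, $p(A) \ge 0$ entrywise for every entrywise nonnegative $n$-by-$n$ monomial matrix $A$) if and only if $p_{(r,k)} \in \mathscr{P}_1$ for all $k \in \{1,\ldots,n\}$ and all $r \in \{0,\ldots,k-1\}$.
   Context: All inequalities between matrices are entrywise. A matrix $A \in \mathsf{M}_n(\mathbb{C})$ is called monomial if $A = DP$ for some invertible diagonal matrix $D$ and some permutation matrix $P$. $\mathscr{P}_n^{\rm mon}$ denotes the set of polynomials $p \in \mathbb{R}[t]$ such that $p(A) \ge 0$ for every real $n$-by-$n$ monomial matrix $A$ with $A \ge 0$. $\mathscr{P}_1$ denotes the set of polynomials $f \in \mathbb{R}[t]$ such that $f(a) \ge 0$ for all real $a \ge 0$. For $p(t) = \sum_{j=0}^m a_j t^j$, $k \ge 1$ and $r \in \{0,\ldots,k-1\}$, the $r \bmod k$-part of $p$ is $$p_{(r,k)}(t) = \sum_{\substack{0 \le j \le m \\ j \bmod k = r}} a_j t^j,$$ where an empty sum is the zero polynomial. *)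

theory Defs
  imports
    Complex_Main
    "HOL-Computational_Algebra.Polynomial"
    "HOL-Combinatorics.Permutations"
    "Jordan_Normal_Form.Matrix"
begin

definition permutation_mat :: "'a :: field mat \<Rightarrow> bool" where
  "permutation_mat P \<longleftrightarrow>
     (\<exists>\<sigma>. \<sigma> permutes {0..<dim_row P} \<and>
          P = mat (dim_row P) (dim_row P) (\<lambda>(i, j). if j = \<sigma> i then 1 else 0))"

definition monomial_mat :: "nat \<Rightarrow> 'a :: field mat \<Rightarrow> bool" where
  "monomial_mat n A \<longleftrightarrow>
     (\<exists>D P. D \<in> carrier_mat n n \<and> P \<in> carrier_mat n n \<and>
            diagonal_mat D \<and> invertible_mat D \<and> permutation_mat P \<and> A = D * P)"

text \<open>The value \<open>p(A) = a\<^sub>0 I + a\<^sub>1 A + \<dots> + a\<^sub>m A\<^sup>m\<close>, a sum in the ring of \<open>n \<times> n\<close> matrices,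
  where \<open>A\<close> is square of size \<open>n\<close>.\<close>

definition poly_mat :: "'a :: comm_ring_1 poly \<Rightarrow> 'a mat \<Rightarrow> 'a mat" where
  "poly_mat p A =
     finsum (ring_mat TYPE('a) (dim_row A) ())
       (\<lambda>k. Polynomial.coeff p k \<cdot>\<^sub>m (A ^\<^sub>m k)) {..degree p}"

text \<open>The order on matrices is the entrywise order on matrices of equal dimensions.
  Monomial matrices are defined over the complex numbers, so a real matrix \<open>A\<close> is monomial if its
  image under the inclusion of the reals is.\<close>

definition Pmon :: "nat \<Rightarrow> real poly set" where
  "Pmon n = {p. \<forall>A \<in> carrier_mat n n.
     monomial_mat n (map_mat complex_of_real A) \<and> 0\<^sub>m n n \<le> A \<longrightarrow> 0\<^sub>m n n \<le> poly_mat p A}"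

definition P1 :: "real poly set" where
  "P1 = {f. \<forall>a \<ge> 0. poly f a \<ge> 0}"

definition mod_part :: "nat \<Rightarrow> nat \<Rightarrow> real poly \<Rightarrow> real poly" where
  "mod_part r k p =
     (\<Sum>j | j \<le> degree p \<and> j mod k = r. Polynomial.monom (Polynomial.coeff p j) j)"

lemma poly_mat_dims:
  assumes "A \<in> carrier_mat n n"
  shows "poly_mat p A \<in> carrier_mat n n"
    and "i < n \<Longrightarrow> j < n \<Longrightarrow>
      poly_mat p A $$ (i, j) = (\<Sum>k\<le>degree p. Polynomial.coeff p k * (A ^\<^sub>m k) $$ (i, j))"
proof -
  interpret R: ring "ring_mat TYPE('a) n ()" by (rule ring_mat)
  define g where "g k = Polynomial.coeff p k \<cdot>\<^sub>m (A ^\<^sub>m k)" for k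
  have g: "g k \<in> carrier_mat n n" for k
    using assms by (auto simp: g_def)
  have car: "carrier (ring_mat TYPE('a) n ()) = carrier_mat n n"
    by (simp add: ring_mat_def)
  have eq: "poly_mat p A = finsum (ring_mat TYPE('a) n ()) g {..degree p}"
    using assms unfolding poly_mat_def g_def by auto
  have fin: "finsum (ring_mat TYPE('a) n ()) g F \<in> carrier_mat n n" for F
    using R.finsum_closed[of g F] g car by auto
  show "poly_mat p A \<in> carrier_mat n n"
    using fin eq by simp
  assume ij: "i < n" "j < n"
  have "finsum (ring_mat TYPE('a) n ()) g F $$ (i, j) = (\<Sum>k\<in>F. g k $$ (i, j))"
    if "finite F" for F
    using that
  proof induction
    case empty
    have "finsum (ring_mat TYPE('a) n ()) g {} = 0\<^sub>m n n"
      using R.finsum_empty[of g] by (simp only:) (simp add: ring_mat_def)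
    then show ?case using ij by simp
  next
    case (insert x F)
    have "finsum (ring_mat TYPE('a) n ()) g (insert x F) =
        g x + finsum (ring_mat TYPE('a) n ()) g F"
      using insert.hyps g car R.finsum_insert[of F x g] by (auto simp: ring_mat_def)
    then show ?case
      using insert ij fin[of F] g[of x] by auto
  qed
  moreover have "g k $$ (i, j) = Polynomial.coeff p k * (A ^\<^sub>m k) $$ (i, j)" for k
    using ij assms by (auto simp: g_def)
  ultimately show "poly_mat p A $$ (i, j) =
      (\<Sum>k\<le>degree p. Polynomial.coeff p k * (A ^\<^sub>m k) $$ (i, j))"
    using eq by simp
qed

end

theory Submission
  imports Defs "HOL-Combinatorics.Cycles"
begin

text \<open>
  A nonnegative monomial matrix \<open>A\<close> has entries \<open>d\<^sub>i > 0\<close> at the positions \<open>(i, \<sigma> i)\<close>.  If \<open>i\<close> lies on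
  a \<open>\<sigma>\<close>-cycle of length \<open>c \<le> n\<close> and \<open>j = \<sigma>\<^sup>r i\<close> with \<open>r < c\<close>, then only the powers \<open>A\<^sup>k\<close> with
  \<open>k mod c = r\<close> contribute to \<open>p(A)\<^sub>i\<^sub>j\<close>, and the weight of the \<open>k\<close>-th power is \<open>w\<^sub>r t\<^bsup>k - r\<^esup>\<close>, where
  \<open>t\<close> is the geometric mean of the weights on the cycle.  So \<open>p(A)\<^sub>i\<^sub>j\<close> is a positive multiple of
  \<open>p\<^bsub>(r,c)\<^esub>(t)\<close>.  Conversely, \<open>p\<^bsub>(r,k)\<^esub>(t)\<close> for \<open>t > 0\<close> is an entry of \<open>p(A)\<close> when \<open>A\<close> is \<open>t\<close> times
  the permutation matrix of a \<open>k\<close>-cycle, and \<open>t = 0\<close> follows by continuity.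
\<close>

section \<open>Monomial matrices as weighted permutation matrices\<close>

definition weighted_perm_mat :: "nat \<Rightarrow> (nat \<Rightarrow> nat) \<Rightarrow> (nat \<Rightarrow> 'a :: zero) \<Rightarrow> 'a mat" where
  "weighted_perm_mat n \<sigma> d = mat n n (\<lambda>(i, j). if j = \<sigma> i then d i else 0)"

lemma weighted_perm_mat_carrier [simp]: "weighted_perm_mat n \<sigma> d \<in> carrier_mat n n"
  by (simp add: weighted_perm_mat_def)

lemma weighted_perm_mat_index [simp]:
  "i < n \<Longrightarrow> j < n \<Longrightarrow> weighted_perm_mat n \<sigma> d $$ (i, j) = (if j = \<sigma> i then d i else 0)"
  by (simp add: weighted_perm_mat_def)

text \<open>Left multiplication by a diagonal matrix scales the rows of the permutation matrix, and
  a diagonal matrix is invertible exactly when its diagonal has no zero.\<close>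

lemma monomial_mat_iff:
  "monomial_mat n A \<longleftrightarrow>
    (\<exists>\<sigma> d. \<sigma> permutes {0..<n} \<and> (\<forall>i<n. d i \<noteq> 0) \<and> A = weighted_perm_mat n \<sigma> d)"
proof
  assume "monomial_mat n A"
  then obtain D P where D: "D \<in> carrier_mat n n" and P: "P \<in> carrier_mat n n"
    and diag: "diagonal_mat D" and inv: "invertible_mat D" and perm: "permutation_mat P"
    and A: "A = D * P"
    unfolding monomial_mat_def by blast
  from perm P obtain \<sigma> where \<sigma>: "\<sigma> permutes {0..<n}"
    and P_eq: "P = mat n n (\<lambda>(i, j). if j = \<sigma> i then 1 else 0)"
    unfolding permutation_mat_def by auto
  define d where "d i = D $$ (i, i)" for i
  have D_eq: "D = mat_diag n d"
    using D diag by (intro eq_matI) (auto simp: mat_diag_def d_def diagonal_mat_def)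
  from inv D obtain B where DB: "D * B = 1\<^sub>m n" and BD: "B * D = 1\<^sub>m (dim_row B)"
    unfolding invertible_mat_def inverts_mat_def by auto
  \<comment> \<open>\<open>invertible_mat\<close> says nothing about the size of \<open>B\<close>;
    comparing column counts in both inverse equations forces it to be n by n.\<close>
  have "dim_col (D * B) = n" "dim_col (B * D) = dim_row B"
    unfolding DB BD by simp_all
  with D have B: "B \<in> carrier_mat n n" by auto
  have "d i \<noteq> 0" if "i < n" for i
  proof
    assume "d i = 0"
    have "(D * B) $$ (i, i) = d i * B $$ (i, i)"
      using that by (simp add: D_eq mat_diag_mult_left[OF B])
    with DB that \<open>d i = 0\<close> show False by simp
  qed
  moreover have "A = weighted_perm_mat n \<sigma> d"
    unfolding A D_eq mat_diag_mult_left[OF P] weighted_perm_mat_def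
    by (intro eq_matI) (auto simp: P_eq)
  ultimately show "\<exists>\<sigma> d. \<sigma> permutes {0..<n} \<and> (\<forall>i<n. d i \<noteq> 0) \<and> A = weighted_perm_mat n \<sigma> d"
    using \<sigma> by blast
next
  assume "\<exists>\<sigma> d. \<sigma> permutes {0..<n} \<and> (\<forall>i<n. d i \<noteq> 0) \<and> A = weighted_perm_mat n \<sigma> d"
  then obtain \<sigma> d where \<sigma>: "\<sigma> permutes {0..<n}" and d: "\<And>i. i < n \<Longrightarrow> d i \<noteq> 0"
    and A: "A = weighted_perm_mat n \<sigma> d" by blast
  let ?P = "mat n n (\<lambda>(i, j). if j = \<sigma> i then 1 else 0)"
  have "mat_diag n (\<lambda>i. d i * inverse (d i)) = 1\<^sub>m n" "mat_diag n (\<lambda>i. inverse (d i) * d i) = 1\<^sub>m n"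
    using d by (auto intro!: eq_matI simp: mat_diag_def)
  then have "invertible_mat (mat_diag n d)"
    unfolding invertible_mat_def inverts_mat_def
    by (auto intro!: exI[of _ "mat_diag n (\<lambda>i. inverse (d i))"] simp: carrier_matD[OF mat_diag_dim])
  moreover have "diagonal_mat (mat_diag n d)"
    by (auto simp: diagonal_mat_def mat_diag_def)
  moreover have "permutation_mat ?P"
    using \<sigma> unfolding permutation_mat_def by auto
  moreover have "A = mat_diag n d * ?P"
    unfolding A weighted_perm_mat_def
    by (subst mat_diag_mult_left[of _ n n]) (auto intro!: eq_matI)
  ultimately show "monomial_mat n A"
    unfolding monomial_mat_def using mat_diag_dim mat_carrier by blast
qed

section \<open>Powers of a weighted permutation matrix and weights of walks\<close>

definition path_weight :: "('b \<Rightarrow> 'b) \<Rightarrow> ('b \<Rightarrow> 'a) \<Rightarrow> 'b \<Rightarrow> nat \<Rightarrow> 'a :: comm_monoid_mult" where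
  "path_weight \<sigma> d i k = (\<Prod>l<k. d ((\<sigma> ^^ l) i))"

lemma path_weight_0 [simp]: "path_weight \<sigma> d i 0 = 1"
  by (simp add: path_weight_def)

lemma path_weight_Suc [simp]: "path_weight \<sigma> d i (Suc k) = path_weight \<sigma> d i k * d ((\<sigma> ^^ k) i)"
  by (simp add: path_weight_def)

lemma path_weight_add:
  "path_weight \<sigma> d i (k + l) = path_weight \<sigma> d i k * path_weight \<sigma> d ((\<sigma> ^^ k) i) l"
proof (induction l)
  case (Suc l)
  have "(\<sigma> ^^ (k + l)) i = (\<sigma> ^^ l) ((\<sigma> ^^ k) i)"
    by (simp add: add.commute[of k] funpow_add)
  then show ?case using Suc by (simp add: mult.assoc)
qed simp

text \<open>Each full turn returns to \<open>i\<close> and contributes the same factor, so the turns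
  split off one at a time from the front.\<close>

lemma path_weight_periodic:
  assumes "(\<sigma> ^^ c) i = i"
  shows "path_weight \<sigma> d i (q * c + r) = path_weight \<sigma> d i c ^ q * path_weight \<sigma> d i r"
  by (induction q) (simp_all add: add.assoc path_weight_add[of \<sigma> d i c] assms mult.assoc)

lemma funpow_permutes_less:
  fixes \<sigma> :: "nat \<Rightarrow> nat"
  assumes "\<sigma> permutes {0..<n}" "i < n"
  shows "(\<sigma> ^^ k) i < n"
  using permutes_in_image[OF permutes_funpow[OF assms(1)], of k i] assms(2) by simp

lemma path_weight_pos:
  fixes d :: "nat \<Rightarrow> 'a :: linordered_semidom"
  assumes "\<sigma> permutes {0..<n}" "i < n" "\<And>l. l < n \<Longrightarrow> 0 < d l"
  shows "0 < path_weight \<sigma> d i k"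
  unfolding path_weight_def by (intro prod_pos ballI assms funpow_permutes_less[OF assms(1)])

text \<open>Each row has a single nonzero entry, so the sum in the matrix product collapses to one
  term: from \<open>i\<close> there is exactly one walk of length \<open>k\<close>, and
  \<open>path_weight\<close> multiplies the weights along it.\<close>

lemma weighted_perm_mat_power:
  fixes d :: "nat \<Rightarrow> 'a :: comm_semiring_1"
  assumes \<sigma>: "\<sigma> permutes {0..<n}" and i: "i < n" and j: "j < n"
  shows "(weighted_perm_mat n \<sigma> d ^\<^sub>m k) $$ (i, j) =
    (if j = (\<sigma> ^^ k) i then path_weight \<sigma> d i k else 0)"
  using j
proof (induction k arbitrary: j)
  case 0
  then show ?case using i by (auto simp: weighted_perm_mat_def)
next
  case (Suc k)
  let ?A = "weighted_perm_mat n \<sigma> d"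
  note less = funpow_permutes_less[OF \<sigma> i, of k]
  have "(?A ^\<^sub>m Suc k) $$ (i, j) = (\<Sum>l\<in>{0..<n}. (?A ^\<^sub>m k) $$ (i, l) * ?A $$ (l, j))"
    using i Suc.prems pow_carrier_mat[OF weighted_perm_mat_carrier, of n \<sigma> d k]
      carrier_matD[OF weighted_perm_mat_carrier, of n \<sigma> d]
    by (simp add: scalar_prod_def)
  also have "\<dots> = (\<Sum>l\<in>{0..<n}. if l = (\<sigma> ^^ k) i then path_weight \<sigma> d i k * ?A $$ (l, j) else 0)"
    by (intro sum.cong) (auto simp: Suc.IH)
  also have "\<dots> = path_weight \<sigma> d i k * ?A $$ ((\<sigma> ^^ k) i, j)"
    using less by simp
  finally show ?case using less Suc.prems by simp
qed

lemma poly_weighted_perm_mat: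
  fixes p :: "'a :: comm_ring_1 poly"
  assumes \<sigma>: "\<sigma> permutes {0..<n}" and i: "i < n" and j: "j < n"
  shows "poly_mat p (weighted_perm_mat n \<sigma> d) $$ (i, j) =
    (\<Sum>k | k \<le> degree p \<and> (\<sigma> ^^ k) i = j. coeff p k * path_weight \<sigma> d i k)"
proof -
  have "poly_mat p (weighted_perm_mat n \<sigma> d) $$ (i, j) =
      (\<Sum>k\<le>degree p. if (\<sigma> ^^ k) i = j then coeff p k * path_weight \<sigma> d i k else 0)"
    unfolding poly_mat_dims(2)[OF weighted_perm_mat_carrier i j]
    by (intro sum.cong) (auto simp: weighted_perm_mat_power[OF assms])
  also have "\<dots> = (\<Sum>k | k \<le> degree p \<and> (\<sigma> ^^ k) i = j. coeff p k * path_weight \<sigma> d i k)"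
    by (subst sum.inter_filter[symmetric]) auto
  finally show ?thesis .
qed

section \<open>Residue classes modulo the cycle length\<close>

lemma poly_mod_part:
  "poly (mod_part r k p) x = (\<Sum>j | j \<le> degree p \<and> j mod k = r. coeff p j * x ^ j)"
  by (simp add: mod_part_def poly_sum poly_monom)

text \<open>The iterates of \<open>i\<close> below the cycle length are distinct points of
  \<open>{0..<n}\<close>. This keeps the modulus within the range \<open>1..n\<close> of the
  theorem.\<close>

lemma least_power_le_card:
  fixes \<sigma> :: "nat \<Rightarrow> nat"
  assumes \<sigma>: "\<sigma> permutes {0..<n}" and i: "i < n"
  shows "least_power \<sigma> i \<le> n"
proof -
  let ?c = "least_power \<sigma> i"
  have perm: "permutation \<sigma>" using \<sigma> permutation_permutes by blast
  have "inj_on (\<lambda>k. (\<sigma> ^^ k) i) {0..<?c}"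
    using least_power_of_permutation(1)[OF perm] least_power_le[where f = \<sigma> and x = i]
    by (intro inj_on_funpow_least) (auto dest: leD)
  moreover have "(\<lambda>k. (\<sigma> ^^ k) i) ` {0..<?c} \<subseteq> {0..<n}"
    using funpow_permutes_less[OF assms] by auto
  ultimately have "card {0..<?c} \<le> card {0..<n}"
    by (rule card_inj_on_le) simp
  then show ?thesis by simp
qed

lemma funpow_eq_iff_mod_least_power:
  assumes "permutation \<sigma>"
  shows "(\<sigma> ^^ k) i = (\<sigma> ^^ l) i \<longleftrightarrow> k mod least_power \<sigma> i = l mod least_power \<sigma> i"
proof -
  let ?c = "least_power \<sigma> i"
  note c = least_power_of_permutation[OF assms, of i]
  have "inj_on (\<lambda>k. (\<sigma> ^^ k) i) {0..<?c}"
    using c(1) least_power_le[where f = \<sigma> and x = i]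
    by (intro inj_on_funpow_least) (auto dest: leD)
  then have "(\<sigma> ^^ (k mod ?c)) i = (\<sigma> ^^ (l mod ?c)) i \<longleftrightarrow> k mod ?c = l mod ?c"
    using c(2) by (auto dest: inj_onD)
  then show ?thesis by (simp add: funpow_mod_eq[OF c(1)])
qed

text \<open>With this \<open>t\<close> one full turn has weight \<open>t ^ c\<close>, just as if
  every weight on the cycle were \<open>t\<close>; the true weights matter only for the remaining
  \<open>r\<close> steps, and these give a factor common to all exponents congruent to
  \<open>r\<close>.\<close>

lemma poly_weighted_perm_mat_eq_mod_part:
  fixes d :: "nat \<Rightarrow> real"
  assumes \<sigma>: "\<sigma> permutes {0..<n}" and i: "i < n" and pos: "\<And>l. l < n \<Longrightarrow> 0 < d l"
  defines "c \<equiv> least_power \<sigma> i"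
  defines "t \<equiv> root c (path_weight \<sigma> d i c)"
  assumes r: "r < c"
  shows "t > 0"
    and "poly_mat p (weighted_perm_mat n \<sigma> d) $$ (i, (\<sigma> ^^ r) i) =
      path_weight \<sigma> d i r / t ^ r * poly (mod_part r c p) t"
proof -
  have perm: "permutation \<sigma>" using \<sigma> permutation_permutes by blast
  have c: "(\<sigma> ^^ c) i = i" "c > 0"
    unfolding c_def using least_power_of_permutation[OF perm] by auto
  have W: "path_weight \<sigma> d i c > 0"
    by (rule path_weight_pos[OF \<sigma> i pos])
  with c show t: "t > 0" by (simp add: t_def)
  have tc: "path_weight \<sigma> d i c = t ^ c"
    using W c by (simp add: t_def)
  have weight: "path_weight \<sigma> d i k = path_weight \<sigma> d i r / t ^ r * t ^ k" if "k mod c = r" for k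
  proof -
    \<comment> \<open>The walk consists of \<open>k div c\<close> full turns followed by
      \<open>r\<close> steps.\<close>
    have k: "k = k div c * c + r" using that by (metis div_mult_mod_eq)
    have "path_weight \<sigma> d i k = path_weight \<sigma> d i c ^ (k div c) * path_weight \<sigma> d i r"
      by (subst k, rule path_weight_periodic[OF c(1)])
    also have "path_weight \<sigma> d i c ^ (k div c) = t ^ (k div c * c)"
      by (simp add: tc power_mult[symmetric] mult.commute)
    also have "t ^ (k div c * c) = t ^ k / t ^ r"
      using t by (subst (2) k) (simp add: power_add)
    finally show ?thesis by simp
  qed
  have "poly_mat p (weighted_perm_mat n \<sigma> d) $$ (i, (\<sigma> ^^ r) i) =
      (\<Sum>k | k \<le> degree p \<and> k mod c = r. coeff p k * path_weight \<sigma> d i k)"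
    unfolding poly_weighted_perm_mat[OF \<sigma> i funpow_permutes_less[OF \<sigma> i]]
      funpow_eq_iff_mod_least_power[OF perm] c_def[symmetric]
    using r by simp
  also have "\<dots> = path_weight \<sigma> d i r / t ^ r * poly (mod_part r c p) t"
    unfolding poly_mod_part sum_distrib_left
  proof (intro sum.cong refl)
    fix k assume "k \<in> {k. k \<le> degree p \<and> k mod c = r}"
    then show "coeff p k * path_weight \<sigma> d i k =
        path_weight \<sigma> d i r / t ^ r * (coeff p k * t ^ k)"
      using weight[of k] by simp
  qed
  finally show "poly_mat p (weighted_perm_mat n \<sigma> d) $$ (i, (\<sigma> ^^ r) i) =
      path_weight \<sigma> d i r / t ^ r * poly (mod_part r c p) t" .
qed

section \<open>Reduction of \<open>Pmon\<close> to positive real weights\<close>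

lemma nonneg_monomial_mat_iff:
  fixes A :: "real mat"
  shows "A \<in> carrier_mat n n \<and> monomial_mat n (map_mat complex_of_real A) \<and> 0\<^sub>m n n \<le> A \<longleftrightarrow>
    (\<exists>\<sigma> d. \<sigma> permutes {0..<n} \<and> (\<forall>i<n. 0 < d i) \<and> A = weighted_perm_mat n \<sigma> d)"
    (is "?L \<longleftrightarrow> ?R")
proof
  assume L: ?L
  then have A: "A \<in> carrier_mat n n" and "0\<^sub>m n n \<le> A" by blast+
  then have nonneg: "0 \<le> A $$ (i, j)" if "i < n" "j < n" for i j
    using that by (simp add: less_eq_mat_def)
  from L obtain \<sigma> d where \<sigma>: "\<sigma> permutes {0..<n}" and d: "\<And>i. i < n \<Longrightarrow> d i \<noteq> 0"
    and eq: "map_mat complex_of_real A = weighted_perm_mat n \<sigma> d"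
    unfolding monomial_mat_iff by blast
  have entry: "complex_of_real (A $$ (i, j)) = (if j = \<sigma> i then d i else 0)"
    if "i < n" "j < n" for i j
    using arg_cong[OF eq, of "\<lambda>M. M $$ (i, j)"] that A by simp
  \<comment> \<open>The entry is nonnegative by the order and nonzero by monomiality over the
    complex numbers. These real entries then replace the complex weights \<open>d\<close>.\<close>
  have "0 < A $$ (i, \<sigma> i)" if "i < n" for i
  proof -
    have "\<sigma> i < n" using funpow_permutes_less[OF \<sigma> that, of 1] by simp
    then have "0 \<le> A $$ (i, \<sigma> i)"
      using nonneg that by blast
    moreover have "complex_of_real (A $$ (i, \<sigma> i)) \<noteq> 0"
      using entry[OF that \<open>\<sigma> i < n\<close>] d[OF that] by presburger
    ultimately show ?thesis by (metis of_real_0 order_less_le)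
  qed
  moreover have "A = weighted_perm_mat n \<sigma> (\<lambda>i. A $$ (i, \<sigma> i))"
    (is "_ = ?B")
  proof (rule eq_matI)
    fix i j assume "i < dim_row ?B" "j < dim_col ?B"
    then show "A $$ (i, j) = ?B $$ (i, j)"
      using entry[of i j] by (auto simp: weighted_perm_mat_def)
  qed (simp_all add: carrier_matD[OF A] weighted_perm_mat_def)
  ultimately show ?R
    by (intro exI[of _ \<sigma>] exI[of _ "\<lambda>i. A $$ (i, \<sigma> i)"] conjI allI impI \<sigma>)
next
  assume ?R
  then obtain \<sigma> d where \<sigma>: "\<sigma> permutes {0..<n}" and d: "\<And>i. i < n \<Longrightarrow> 0 < d i"
    and A: "A = weighted_perm_mat n \<sigma> d" by blast
  have "map_mat complex_of_real A = weighted_perm_mat n \<sigma> (\<lambda>i. complex_of_real (d i))"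
    by (intro eq_matI) (auto simp: A weighted_perm_mat_def)
  moreover have "\<forall>i<n. complex_of_real (d i) \<noteq> 0"
    using d by force
  moreover have "0\<^sub>m n n \<le> A"
    using d by (auto simp: less_eq_mat_def A weighted_perm_mat_def less_imp_le)
  moreover have "A \<in> carrier_mat n n" by (simp add: A)
  ultimately show ?L
    unfolding monomial_mat_iff
    by (intro conjI exI[of _ \<sigma>] exI[of _ "\<lambda>i. complex_of_real (d i)"] \<sigma>)
qed

lemma Pmon_iff:
  "p \<in> Pmon n \<longleftrightarrow>
    (\<forall>\<sigma> d. \<sigma> permutes {0..<n} \<longrightarrow> (\<forall>l<n. 0 < d l) \<longrightarrow>
      (\<forall>i<n. \<forall>j<n. 0 \<le> poly_mat p (weighted_perm_mat n \<sigma> d) $$ (i, j)))"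
proof -
  have "p \<in> Pmon n \<longleftrightarrow> (\<forall>A. (A \<in> carrier_mat n n \<and> monomial_mat n (map_mat complex_of_real A) \<and>
      0\<^sub>m n n \<le> A) \<longrightarrow> 0\<^sub>m n n \<le> poly_mat p A)"
    unfolding Pmon_def by auto
  also have "\<dots> \<longleftrightarrow> (\<forall>\<sigma> d. \<sigma> permutes {0..<n} \<longrightarrow> (\<forall>l<n. 0 < d l) \<longrightarrow>
      0\<^sub>m n n \<le> poly_mat p (weighted_perm_mat n \<sigma> d))"
    unfolding nonneg_monomial_mat_iff by blast
  also have "\<dots> \<longleftrightarrow> (\<forall>\<sigma> d. \<sigma> permutes {0..<n} \<longrightarrow> (\<forall>l<n. 0 < d l) \<longrightarrow>
      (\<forall>i<n. \<forall>j<n. 0 \<le> poly_mat p (weighted_perm_mat n \<sigma> d) $$ (i, j)))"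
    by (simp add: less_eq_mat_def carrier_matD[OF poly_mat_dims(1)[OF weighted_perm_mat_carrier]])
  finally show ?thesis .
qed

section \<open>Test matrices from a single cycle\<close>

definition initial_cycle :: "nat \<Rightarrow> nat \<Rightarrow> nat" where
  "initial_cycle k i = (if i < k then Suc i mod k else i)"

lemma initial_cycle_permutes:
  assumes "k \<le> n"
  shows "initial_cycle k permutes {0..<n}"
proof (rule permutes_subset)
  have inj: "inj_on (initial_cycle k) {0..<k}"
    by (rule inj_onI) (auto simp: initial_cycle_def mod_Suc split: if_splits)
  have "initial_cycle k ` {0..<k} \<subseteq> {0..<k}"
    by (auto simp: initial_cycle_def)
  with inj have "bij_betw (initial_cycle k) {0..<k} {0..<k}"
    by (simp add: bij_betw_def endo_inj_surj)
  then show "initial_cycle k permutes {0..<k}"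
    by (rule bij_imp_permutes) (simp add: initial_cycle_def)
  show "{0..<k} \<subseteq> {0..<n}" using assms by simp
qed

lemma funpow_initial_cycle: "k > 0 \<Longrightarrow> (initial_cycle k ^^ l) 0 = l mod k"
  by (induction l) (simp_all add: initial_cycle_def mod_Suc_eq)

text \<open>The value at 0 is the limit of nonnegative values from the right. Weights of monomial
  matrices are nonzero, so the test matrices only reach \<open>t > 0\<close>.\<close>

lemma P1_iff_pos: "f \<in> P1 \<longleftrightarrow> (\<forall>t>0. 0 \<le> poly f t)"
proof
  assume pos: "\<forall>t>0. 0 \<le> poly f t"
  have "(poly f \<longlongrightarrow> poly f 0) (at_right 0)"
    using poly_isCont[of 0 f] unfolding isCont_def by (rule filterlim_mono) (auto intro: at_le)
  then have "0 \<le> poly f 0"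
    by (rule tendsto_lowerbound)
      (use pos in \<open>auto intro: eventually_at_rightI[of 0 1]\<close>)
  with pos show "f \<in> P1"
    unfolding P1_def by (auto simp: order.order_iff_strict)
qed (simp add: P1_def)

theorem theorem4p4:
  fixes n m :: nat and a :: "nat \<Rightarrow> real" and p :: "real poly"
  assumes "n \<ge> 1"
    and "p = (\<Sum>k\<le>m. Polynomial.monom (a k) k)"
    and "a m \<noteq> 0"
  shows "p \<in> Pmon n \<longleftrightarrow> (\<forall>k \<in> {1..n}. \<forall>r \<in> {0..k - 1}. mod_part r k p \<in> P1)"
proof
  assume p: "p \<in> Pmon n"
  show "\<forall>k \<in> {1..n}. \<forall>r \<in> {0..k - 1}. mod_part r k p \<in> P1"
  proof (intro ballI)
    fix k r assume "k \<in> {1..n}" and "r \<in> {0..k - 1}"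
    then have k: "0 < k" "k \<le> n" and r: "r < k" by auto
    have "0 \<le> poly (mod_part r k p) t" if "t > 0" for t
    proof -
      \<comment> \<open>With constant weight \<open>t\<close> a walk of length \<open>l\<close> has
        weight \<open>t ^ l\<close>, and from 0 it ends at \<open>l mod k\<close>; hence the entry
        at \<open>(0, r)\<close> collects the exponents congruent to \<open>r\<close>.\<close>
      have "poly (mod_part r k p) t =
          poly_mat p (weighted_perm_mat n (initial_cycle k) (\<lambda>_. t)) $$ (0, r)"
        using k r
        by (simp add: poly_weighted_perm_mat initial_cycle_permutes funpow_initial_cycle
            path_weight_def poly_mod_part)
      then show ?thesis
        using p k r that initial_cycle_permutes[OF k(2)] unfolding Pmon_iff by auto
    qed
    then show "mod_part r k p \<in> P1" by (simp add: P1_iff_pos)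
  qed
next
  assume parts: "\<forall>k \<in> {1..n}. \<forall>r \<in> {0..k - 1}. mod_part r k p \<in> P1"
  show "p \<in> Pmon n"
    unfolding Pmon_iff
  proof (intro allI impI)
    fix \<sigma> i j and d :: "nat \<Rightarrow> real"
    assume \<sigma>: "\<sigma> permutes {0..<n}" and d: "\<forall>l<n. 0 < d l" and i: "i < n" and j: "j < n"
    let ?c = "least_power \<sigma> i"
    have perm: "permutation \<sigma>" using \<sigma> permutation_permutes by blast
    note c = least_power_of_permutation[OF perm, of i]
    show "0 \<le> poly_mat p (weighted_perm_mat n \<sigma> d) $$ (i, j)"
    proof (cases "\<exists>k. (\<sigma> ^^ k) i = j")
      case True
      then obtain k where "(\<sigma> ^^ k) i = j" ..
      \<comment> \<open>Dropping full turns brings the exponent below the cycle length without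
        moving the endpoint \<open>j\<close>.\<close>
      define r where "r = k mod ?c"
      have jr: "j = (\<sigma> ^^ r) i"
        using \<open>(\<sigma> ^^ k) i = j\<close> by (simp add: r_def funpow_mod_eq[OF c(1)])
      have r: "r < ?c" using c(2) by (simp add: r_def)
      define t where "t = root ?c (path_weight \<sigma> d i ?c)"
      have t: "t > 0" and eq: "poly_mat p (weighted_perm_mat n \<sigma> d) $$ (i, j) =
          path_weight \<sigma> d i r / t ^ r * poly (mod_part r ?c p) t"
        using poly_weighted_perm_mat_eq_mod_part[OF \<sigma> i _ r, of d] d
        unfolding t_def jr by auto
      have "mod_part r ?c p \<in> P1"
        using parts r c(2) least_power_le_card[OF \<sigma> i] by auto
      with t have "0 \<le> poly (mod_part r ?c p) t" by (simp add: P1_def)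
      moreover have "0 \<le> path_weight \<sigma> d i r"
        using path_weight_pos[OF \<sigma> i, of d] d by (simp add: less_imp_le)
      ultimately show ?thesis using t unfolding eq by simp
    next
      \<comment> \<open>Here \<open>j\<close> lies off the cycle of \<open>i\<close>, so the sum for
        this entry is empty.\<close>
      case False
      then show ?thesis by (simp add: poly_weighted_perm_mat[OF \<sigma> i j])
    qed
  qed
qed

end
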